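(* Let $I=[0,c]$, let $(\gamma,\eta):I\rightarrow X\times S$ be a Legendre curve with curvature $(\alpha,\kappa)$, and let $T:X\to X$ be an orientation preserving isometry of the plane with linear part $L$ (that is, $T(x)=Lx+w$ for some $w\in X$). Then the Legendre curve $(T\circ\gamma,L\circ\eta)$ has the same curvature $(\alpha,\kappa)$.
   Context: Let $(X,\|\cdot\|)$ be a two-dimensional real normed space with unit circle $S=\{x\in X:\|x\|=1\}$. The plane is assumed smooth ($S$ is a smooth curve) and strictly convex ($S$ contains no line segment). Fix a nondegenerate symplectic (alternating) bilinear form $[\cdot,\cdot]$ on $X$. For $x,y\in X$, $x\dashv_B y$ (Birkhoff orthogonality) means $\|x+ty\|\ge\|x\|$ for all $t\in\mathbb{R}$. For $v\in X\setminus\{o\}$ let $b(v)\in S$ be the unique vector with $v\dashv_B b(v)$ and $[v,b(v)]>0$. A Legendre curve is a smooth map $(\gamma,\eta):I\rightarrow X\times S$ with $\eta(t)\dashv_B\gamma'(t)$ for all $t\in I$. Put $\xi(t)=b(\eta(t))$. There are smooth functions $\alpha,\kappa:I\to\mathbb{R}$ with $\gamma'(t)=\alpha(t)\xi(t)$ and $\eta'(t)=\kappa(t)\xi(t)$; the pair $(\alpha,\kappa)$ is called the curvature of the Legendre curve $(\gamma,\eta)$. An isometry of the plane is a map $T:X\to X$ with $\|T(x)-T(y)\|=\|x-y\|$ for all $x,y$; every isometry is linear up to a translation, i.e. $T(x)=Lx+w$ with $L$ a linear isometry. It is orientation preserving if $[Lx,Ly]$ and $[x,y]$ have the same sign for all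 $x,y\in X$. Since Birkhoff orthogonality is preserved by isometries, $(T\circ\gamma,L\circ\eta)$ is again a Legendre curve. *)

theory Defs
  imports "HOL-Analysis.Analysis"
begin

text \<open>Smoothness means \<open>C\<^sup>\<infinity>\<close> throughout. At an endpoint of a closed interval, the filter
  \<open>at t within A\<close> makes the derivatives one-sided.\<close>

definition smooth_curve_on :: "real set \<Rightarrow> (real \<Rightarrow> 'a::real_normed_vector) \<Rightarrow> bool" where
  "smooth_curve_on A f \<longleftrightarrow>
     (\<exists>D. D 0 = f \<and>
       (\<forall>n::nat. \<forall>t\<in>A. (D n has_vector_derivative D (Suc n) t) (at t within A)))"

text \<open>A simple closed curve with a regular \<open>C\<^sup>\<infinity>\<close> parametrization of minimal period \<open>p\<close>.\<close>

definition smooth_closed_curve :: "'a::real_normed_vector set \<Rightarrow> bool" where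
  "smooth_closed_curve C \<longleftrightarrow>
     (\<exists>\<phi> p. p > 0 \<and> smooth_curve_on UNIV \<phi> \<and> range \<phi> = C \<and>
       (\<forall>t. vector_derivative \<phi> (at t) \<noteq> 0) \<and>
       (\<forall>s t. \<phi> s = \<phi> t \<longleftrightarrow> (\<exists>k::int. t = s + of_int k * p)))"

definition contains_no_segment :: "'a::real_normed_vector set \<Rightarrow> bool" where
  "contains_no_segment C \<longleftrightarrow> (\<forall>x y. x \<noteq> y \<longrightarrow> \<not> closed_segment x y \<subseteq> C)"

definition symplectic_form :: "('a::real_normed_vector \<Rightarrow> 'a \<Rightarrow> real) \<Rightarrow> bool" where
  "symplectic_form \<omega> \<longleftrightarrow>
     bilinear \<omega> \<and> (\<forall>x. \<omega> x x = 0) \<and> (\<forall>x. (\<forall>y. \<omega> x y = 0) \<longrightarrow> x = 0)"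

definition birkhoff_orthogonal :: "'a::real_normed_vector \<Rightarrow> 'a \<Rightarrow> bool"
    (infix "\<stileturn>\<^sub>B" 50) where
  "x \<stileturn>\<^sub>B y \<longleftrightarrow> (\<forall>t::real. norm (x + t *\<^sub>R y) \<ge> norm x)"

text \<open>The map \<open>b\<close>. The description is proper for \<open>v \<noteq> 0\<close> in a smooth plane: existence needs
  dimension two, and uniqueness is exactly the uniqueness of the supporting line of the unit
  circle at \<open>v / norm v\<close> together with the choice of orientation.\<close>

definition birkhoff_normal ::
    "('a::real_normed_vector \<Rightarrow> 'a \<Rightarrow> real) \<Rightarrow> 'a \<Rightarrow> 'a" where
  "birkhoff_normal \<omega> v = (THE u. u \<in> sphere 0 1 \<and> v \<stileturn>\<^sub>B u \<and> \<omega> v u > 0)"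

definition legendre_curve ::
    "real set \<Rightarrow> (real \<Rightarrow> 'a::real_normed_vector) \<Rightarrow> (real \<Rightarrow> 'a) \<Rightarrow> bool" where
  "legendre_curve I \<gamma> \<eta> \<longleftrightarrow>
     smooth_curve_on I \<gamma> \<and> smooth_curve_on I \<eta> \<and>
     (\<forall>t\<in>I. \<eta> t \<in> sphere 0 1 \<and> \<eta> t \<stileturn>\<^sub>B vector_derivative \<gamma> (at t within I))"

text \<open>Curvature is a relation because only the values of \<open>\<alpha>\<close> and \<open>\<kappa>\<close> on \<open>I\<close> matter; there they
  are determined by the two equations, since \<open>\<xi> t = birkhoff_normal \<omega> (\<eta> t)\<close> is a unit vector.\<close>

definition has_curvature ::
    "('a::real_normed_vector \<Rightarrow> 'a \<Rightarrow> real) \<Rightarrow> real set \<Rightarrow> (real \<Rightarrow> 'a) \<Rightarrow> (real \<Rightarrow> 'a) \<Rightarrow>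
     (real \<Rightarrow> real) \<Rightarrow> (real \<Rightarrow> real) \<Rightarrow> bool" where
  "has_curvature \<omega> I \<gamma> \<eta> \<alpha> \<kappa> \<longleftrightarrow>
     smooth_curve_on I \<alpha> \<and> smooth_curve_on I \<kappa> \<and>
     (\<forall>t\<in>I. (\<gamma> has_vector_derivative \<alpha> t *\<^sub>R birkhoff_normal \<omega> (\<eta> t)) (at t within I) \<and>
            (\<eta> has_vector_derivative \<kappa> t *\<^sub>R birkhoff_normal \<omega> (\<eta> t)) (at t within I))"

definition plane_isometry :: "('a::real_normed_vector \<Rightarrow> 'a) \<Rightarrow> bool" where
  "plane_isometry T \<longleftrightarrow> (\<forall>x y. norm (T x - T y) = norm (x - y))"

text \<open>Applied to the linear part of an isometry.\<close>

definition orientation_preserving ::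
    "('a::real_normed_vector \<Rightarrow> 'a \<Rightarrow> real) \<Rightarrow> ('a \<Rightarrow> 'a) \<Rightarrow> bool" where
  "orientation_preserving \<omega> L \<longleftrightarrow> (\<forall>x y. sgn (\<omega> (L x) (L y)) = sgn (\<omega> x y))"

end

theory Submission
  imports Defs
begin

text \<open>
  Write \<open>b v\<close> for \<open>birkhoff_normal \<omega> v\<close>. A linear isometry \<open>L\<close> preserves norms and
  hence Birkhoff orthogonality; being orientation preserving, it also preserves the sign of
  \<open>\<omega>\<close>. So \<open>L (b v)\<close> has the three properties that characterize \<open>b (L v)\<close>, and
  \<open>L \<circ> b = b \<circ> L\<close> on the unit circle. Differentiating \<open>T \<circ> \<gamma>\<close> and \<open>L \<circ> \<eta>\<close> then
  only applies \<open>L\<close> to \<open>\<alpha> t *\<^sub>R b (\<eta> t)\<close> and \<open>\<kappa> t *\<^sub>R b (\<eta> t)\<close>, which moves the frame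
  and leaves the two coefficients alone.

  The substance is that \<open>b\<close> is well defined: it is a definite description, so \<open>L (b v)\<close> and
  \<open>b (L v)\<close> can be identified only once exactly one vector is known to have the three
  properties. Let \<open>v\<close> be a point of the unit circle and \<open>d\<close> a nonzero velocity of a curve
  running in the circle through \<open>v\<close>. Convexity of the norm gives \<open>v \<stileturn>\<^sub>B d\<close>
  (\<open>birkhoff_orthogonal_tangent\<close>), which yields existence. Conversely, if \<open>v \<stileturn>\<^sub>B u\<close>, the
  linear functional that is \<open>1\<close> at \<open>v\<close> and \<open>0\<close> at \<open>u\<close> is bounded by the norm, so along the curve
  it is maximal at \<open>v\<close>, its derivative vanishes there, and \<open>d\<close> is parallel to \<open>u\<close>
  (\<open>tangent_parallel_birkhoff_orthogonal\<close>). Thus \<open>u\<close> is determined up to a factor, which the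
  unit length and the sign of \<open>\<omega> v u\<close> fix.
\<close>

section \<open>Birkhoff orthogonality in a plane\<close>

lemma plane_coordinates:
  fixes v u x :: "'a::real_normed_vector"
  assumes dim2: "dim (UNIV :: 'a set) = 2"
    and ind: "v \<notin> span {u}" and "u \<noteq> 0"
  obtains a b where "x = a *\<^sub>R v + b *\<^sub>R u"
proof -
  obtain B :: "'a set" where B: "independent B" "UNIV \<subseteq> span B" "card B = 2"
    using real_vector.basis_exists[of "UNIV :: 'a set"] dim2 by metis
  have finB: "finite B" using B(3) by (metis card.infinite zero_neq_numeral)
  have ne: "v \<noteq> u" using ind by (metis real_vector.span_base singletonI)
  have vu: "independent {v, u}"
    using ind \<open>u \<noteq> 0\<close> by (simp add: real_vector.independent_insert)
  have "x \<in> span {v, u}"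
  proof (rule ccontr)
    assume x: "x \<notin> span {v, u}"
    then have notin: "x \<notin> {v, u}" by (metis real_vector.span_base)
    with x vu have "independent {x, v, u}" by (simp add: real_vector.independent_insert)
    then have "card {x, v, u} \<le> card B"
      using real_vector.independent_span_bound[OF finB] B(2) by blast
    then show False using B(3) ne notin by simp
  qed
  then obtain a where "x - a *\<^sub>R v \<in> span {u}"
    by (auto simp: real_vector.span_breakdown_eq)
  then obtain b where "x - a *\<^sub>R v = b *\<^sub>R u"
    by (auto simp: real_vector.span_singleton)
  then show ?thesis by (intro that[of a b]) (simp add: algebra_simps)
qed

lemma birkhoff_orthogonal_scale:
  assumes "v \<stileturn>\<^sub>B u"
  shows "v \<stileturn>\<^sub>B r *\<^sub>R u"
  using assms by (simp add: birkhoff_orthogonal_def)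

lemma birkhoff_orthogonal_not_parallel:
  assumes "v \<stileturn>\<^sub>B u" and "v \<noteq> 0"
  shows "v \<notin> span {u}"
proof
  assume "v \<in> span {u}"
  then obtain k where "v = k *\<^sub>R u" by (auto simp: real_vector.span_singleton)
  then have "norm (v + (- k) *\<^sub>R u) = 0" by simp
  then show False using assms by (metis birkhoff_orthogonal_def norm_le_zero_iff)
qed

text \<open>Orthogonal nonzero vectors form a basis of the plane, so if \<open>\<omega> v u\<close> vanished, \<open>v\<close> would lie
  in the radical of \<open>\<omega>\<close>.\<close>

lemma birkhoff_orthogonal_symplectic_nonzero:
  fixes \<omega> :: "'a::real_normed_vector \<Rightarrow> 'a \<Rightarrow> real"
  assumes "dim (UNIV :: 'a set) = 2" and \<omega>: "symplectic_form \<omega>"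
    and vu: "v \<stileturn>\<^sub>B u" and "v \<noteq> 0" "u \<noteq> 0"
  shows "\<omega> v u \<noteq> 0"
proof
  assume zero: "\<omega> v u = 0"
  interpret bilinear_v: linear "\<omega> v"
    using \<omega> by (simp add: symplectic_form_def bilinear_def)
  have "\<omega> v x = 0" for x
  proof -
    obtain a b where "x = a *\<^sub>R v + b *\<^sub>R u"
      using plane_coordinates[OF assms(1) birkhoff_orthogonal_not_parallel[OF vu \<open>v \<noteq> 0\<close>] \<open>u \<noteq> 0\<close>] .
    then show ?thesis
      using zero \<omega> by (simp add: bilinear_v.add bilinear_v.scale symplectic_form_def)
  qed
  then show False using \<omega> \<open>v \<noteq> 0\<close> by (simp add: symplectic_form_def)
qed

section \<open>Tangents of the unit circle\<close>

text \<open>The convex function \<open>h \<mapsto> norm (\<phi> s + h *\<^sub>R d)\<close> differs from the constant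
  \<open>norm (\<phi> (s + h)) = 1\<close> by \<open>o(h)\<close>, so its derivative at \<open>0\<close> is \<open>0\<close>, and a convex function is minimal at a critical
  point.\<close>

lemma birkhoff_orthogonal_tangent:
  fixes \<phi> :: "real \<Rightarrow> 'a::real_normed_vector"
  assumes der: "(\<phi> has_vector_derivative d) (at s)"
    and unit: "\<And>t. norm (\<phi> t) = 1"
  shows "\<phi> s \<stileturn>\<^sub>B d"
  unfolding birkhoff_orthogonal_def
proof
  fix r :: real
  define q where "q h = norm (\<phi> (s + h * r) - \<phi> s - h *\<^sub>R r *\<^sub>R d) / norm h" for h
  have "((\<lambda>h. s + h * r) has_vector_derivative r) (at 0)"
    by (auto intro!: derivative_eq_intros simp: has_real_derivative_iff_has_vector_derivative[symmetric])
  then have "((\<lambda>h. \<phi> (s + h * r)) has_vector_derivative r *\<^sub>R d) (at 0)"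
    using vector_diff_chain_at[of "\<lambda>h. s + h * r" r 0 \<phi> d] der by (simp add: o_def)
  then have "(q \<longlongrightarrow> 0) (at 0)"
    unfolding has_vector_derivative_def has_derivative_at q_def by simp
  then have lim: "((\<lambda>h. 1 - q h) \<longlongrightarrow> 1 - 0) (at_right 0)"
    by (intro tendsto_intros) (rule tendsto_mono[OF at_le[OF subset_UNIV]])
  have "eventually (\<lambda>h. h \<in> {0<..<1}) (at_right (0::real))"
    by (rule eventually_at_right_real) simp
  then have "eventually (\<lambda>h. 1 - q h \<le> norm (\<phi> s + r *\<^sub>R d)) (at_right 0)"
  proof eventually_elim
    case (elim h)
    then have h: "0 < h" "h < 1" by auto
    let ?e = "\<phi> (s + h * r) - \<phi> s - h *\<^sub>R r *\<^sub>R d"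
    \<comment> \<open>Up to the error \<open>?e\<close>, the point of the curve lies on the segment from \<open>\<phi> s\<close> to
      \<open>\<phi> s + r *\<^sub>R d\<close>.\<close>
    have "\<phi> (s + h * r) = (1 - h) *\<^sub>R \<phi> s + h *\<^sub>R (\<phi> s + r *\<^sub>R d) + ?e"
      by (simp add: algebra_simps)
    then have "1 \<le> norm ((1 - h) *\<^sub>R \<phi> s) + norm (h *\<^sub>R (\<phi> s + r *\<^sub>R d)) + norm ?e"
      using unit[of "s + h * r"] by (metis norm_triangle_mono norm_triangle_ineq order_refl)
    moreover have "norm ?e = h * q h" using h by (simp add: q_def)
    ultimately have "1 \<le> (1 - h) + h * norm (\<phi> s + r *\<^sub>R d) + h * q h"
      using h unit[of s] by simp
    then have "h * (1 - q h) \<le> h * norm (\<phi> s + r *\<^sub>R d)"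
      by (simp add: algebra_simps)
    then show ?case using h by simp
  qed
  then have "1 - 0 \<le> norm (\<phi> s + r *\<^sub>R d)"
    by (intro tendsto_upperbound[OF lim]) auto
  then show "norm (\<phi> s) \<le> norm (\<phi> s + r *\<^sub>R d)" using unit[of s] by simp
qed

text \<open>Orthogonality \<open>\<phi> s \<stileturn>\<^sub>B u\<close> makes the first coordinate in the basis \<open>\<phi> s, u\<close> a functional of
  norm at most \<open>1\<close> that attains \<open>1\<close> at \<open>\<phi> s\<close>: the kernel, spanned by \<open>u\<close>, is the direction of a
  supporting line. By Fermat's criterion the tangent vector lies in that kernel.\<close>

lemma tangent_parallel_birkhoff_orthogonal:
  fixes \<phi> :: "real \<Rightarrow> 'a::real_normed_vector"
  assumes dim2: "dim (UNIV :: 'a set) = 2"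
    and der: "(\<phi> has_vector_derivative d) (at s)"
    and unit: "\<And>t. norm (\<phi> t) = 1"
    and orth: "\<phi> s \<stileturn>\<^sub>B u" and "u \<noteq> 0"
  shows "d \<in> span {u}"
proof -
  let ?v = "\<phi> s"
  have v0: "?v \<noteq> 0" using unit[of s] by auto
  have ind: "independent {?v, u}" and ne: "?v \<noteq> u"
    using birkhoff_orthogonal_not_parallel[OF orth v0] \<open>u \<noteq> 0\<close>
    by (auto simp: real_vector.independent_insert real_vector.span_base)
  obtain f :: "'a \<Rightarrow> real" where f: "linear f" "f ?v = 1" "f u = 0"
    using linear_independent_extend[OF ind, of "\<lambda>x. if x = ?v then 1 else 0"] ne by auto
  interpret f: linear f by fact
  have coords: "\<exists>b. x = f x *\<^sub>R ?v + b *\<^sub>R u" for x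
  proof -
    obtain a b where x: "x = a *\<^sub>R ?v + b *\<^sub>R u"
      using plane_coordinates[OF dim2 birkhoff_orthogonal_not_parallel[OF orth v0] \<open>u \<noteq> 0\<close>] .
    then have "f x = a" by (simp add: f.add f.scale f(2,3))
    then show ?thesis using x by metis
  qed
  have bound: "\<bar>f x\<bar> \<le> norm x" for x
  proof (cases "f x = 0")
    case False
    obtain b where "x = f x *\<^sub>R ?v + b *\<^sub>R u" using coords by blast
    then have "x = f x *\<^sub>R (?v + (b / f x) *\<^sub>R u)"
      using False by (simp add: scaleR_add_right)
    then have "norm x = \<bar>f x\<bar> * norm (?v + (b / f x) *\<^sub>R u)" by (metis norm_scaleR)
    moreover have "1 \<le> norm (?v + (b / f x) *\<^sub>R u)"
      using orth unit[of s] by (simp add: birkhoff_orthogonal_def)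
    ultimately show ?thesis by (simp add: mult_le_cancel_left1)
  qed simp
  have "bounded_linear f"
    using bound by (intro bounded_linear_intro[where K = 1]) (auto simp: f.add f.scale)
  then have "((\<lambda>t. f (\<phi> t)) has_real_derivative f d) (at s)"
    using bounded_linear.has_vector_derivative[OF _ der]
    by (simp add: has_real_derivative_iff_has_vector_derivative)
  moreover have "\<forall>t. \<bar>s - t\<bar> < 1 \<longrightarrow> f (\<phi> t) \<le> f (\<phi> s)"
    using bound unit f(2) by (metis abs_le_D1)
  ultimately have "f d = 0" by (rule DERIV_local_max[OF _ zero_less_one])
  then show ?thesis using coords[of d] by (auto simp: real_vector.span_singleton)
qed

section \<open>The map b and its equivariance\<close>

lemma birkhoff_normal_unique:
  fixes \<omega> :: "'a::real_normed_vector \<Rightarrow> 'a \<Rightarrow> real"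
  assumes dim2: "dim (UNIV :: 'a set) = 2"
    and smooth: "smooth_closed_curve (sphere (0::'a) 1)"
    and \<omega>: "symplectic_form \<omega>"
    and v: "v \<in> sphere 0 1"
  shows "\<exists>!u. u \<in> sphere 0 1 \<and> v \<stileturn>\<^sub>B u \<and> \<omega> v u > 0"
proof -
  obtain \<phi> :: "real \<Rightarrow> 'a" where
    \<phi>: "smooth_curve_on UNIV \<phi>" "range \<phi> = sphere 0 1" "\<And>t. vector_derivative \<phi> (at t) \<noteq> 0"
    using smooth unfolding smooth_closed_curve_def by blast
  obtain s where s: "v = \<phi> s" using v \<phi>(2) by blast
  define d where "d = vector_derivative \<phi> (at s)"
  have der: "(\<phi> has_vector_derivative d) (at s)"
    using \<phi>(1) unfolding smooth_curve_on_def d_def by (metis UNIV_I vector_derivative_at)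
  have d0: "d \<noteq> 0" using \<phi>(3) by (simp add: d_def)
  have unit: "norm (\<phi> t) = 1" for t using \<phi>(2) by (metis mem_sphere_0 rangeI)
  have v0: "v \<noteq> 0" using v by auto
  interpret \<omega>v: linear "\<omega> v"
    using \<omega> by (simp add: symplectic_form_def bilinear_def)
  have vd: "v \<stileturn>\<^sub>B d" using birkhoff_orthogonal_tangent[OF der unit] s by simp
  have nz: "\<omega> v d \<noteq> 0"
    using birkhoff_orthogonal_symplectic_nonzero[OF dim2 \<omega> vd v0 d0] .
  define e where "e = (sgn (\<omega> v d) / norm d) *\<^sub>R d"
  have e: "e \<in> sphere 0 1" "v \<stileturn>\<^sub>B e" "\<omega> v e > 0"
    using nz d0 birkhoff_orthogonal_scale[OF vd]
    by (auto simp: e_def \<omega>v.scale abs_sgn_eq sgn_mult_self_eq mult_sgn_abs zero_less_mult_iff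
        zero_less_divide_iff sgn_if)
  have "u = e" if u: "u \<in> sphere 0 1 \<and> v \<stileturn>\<^sub>B u \<and> \<omega> v u > 0" for u
  proof -
    have "u \<noteq> 0" using u by auto
    then have "d \<in> span {u}"
      using tangent_parallel_birkhoff_orthogonal[OF dim2 der unit, of u] u s by simp
    then have "e \<in> span {u}" unfolding e_def by (rule real_vector.span_scale)
    then obtain k where k: "e = k *\<^sub>R u" by (auto simp: real_vector.span_singleton)
    have "\<bar>k\<bar> = 1" using e(1) u k by simp
    moreover have "k > 0" using e(3) u k by (simp add: \<omega>v.scale zero_less_mult_iff)
    ultimately show ?thesis using k by simp
  qed
  with e show ?thesis by blast
qed

lemma birkhoff_orthogonal_linear_isometry:
  assumes "linear L" and "\<And>x. norm (L x) = norm x" and "v \<stileturn>\<^sub>B u"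
  shows "L v \<stileturn>\<^sub>B L u"
  using assms unfolding birkhoff_orthogonal_def
  by (metis linear_add linear_scale)

lemma birkhoff_normal_linear_isometry:
  fixes \<omega> :: "'a::real_normed_vector \<Rightarrow> 'a \<Rightarrow> real"
  assumes "dim (UNIV :: 'a set) = 2"
    and "smooth_closed_curve (sphere (0::'a) 1)"
    and "symplectic_form \<omega>"
    and "linear L" and iso: "\<And>x. norm (L x) = norm x"
    and orient: "orientation_preserving \<omega> L"
    and v: "v \<in> sphere 0 1"
  shows "birkhoff_normal \<omega> (L v) = L (birkhoff_normal \<omega> v)"
proof -
  note unique = birkhoff_normal_unique[OF assms(1-3)]
  have b: "birkhoff_normal \<omega> v \<in> sphere 0 1 \<and> v \<stileturn>\<^sub>B birkhoff_normal \<omega> v \<and>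
      \<omega> v (birkhoff_normal \<omega> v) > 0"
    unfolding birkhoff_normal_def by (rule theI'[OF unique[OF v]])
  have "L v \<in> sphere 0 1" using v iso by simp
  moreover have "\<omega> (L v) (L (birkhoff_normal \<omega> v)) > 0"
    using b orient unfolding orientation_preserving_def by (metis sgn_greater)
  ultimately show ?thesis
    unfolding birkhoff_normal_def[of \<omega> "L v"]
    using b iso birkhoff_orthogonal_linear_isometry[OF \<open>linear L\<close> iso]
    by (intro the1_equality[OF unique]) auto
qed

section \<open>Invariance of the curvature\<close>

lemma smooth_curve_on_affine:
  assumes "bounded_linear L" and "smooth_curve_on A f"
  shows "smooth_curve_on A (\<lambda>t. L (f t) + w)"
proof -
  obtain D where D: "D 0 = f"
    "\<And>n t. t \<in> A \<Longrightarrow> (D n has_vector_derivative D (Suc n) t) (at t within A)"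
    using assms(2) unfolding smooth_curve_on_def by blast
  \<comment> \<open>The translation survives only in the derivative of order \<open>0\<close>.\<close>
  define E where "E n t = L (D n t) + (if n = 0 then w else 0)" for n :: nat and t
  have "(E n has_vector_derivative E (Suc n) t) (at t within A)" if "t \<in> A" for n t
    unfolding E_def has_vector_derivative_add_const
    using bounded_linear.has_vector_derivative[OF assms(1) D(2)[OF that]] by simp
  moreover have "E 0 = (\<lambda>t. L (f t) + w)" by (auto simp: E_def D(1))
  ultimately show ?thesis unfolding smooth_curve_on_def by blast
qed

theorem theorem3p3:
  fixes \<omega> :: "'a::real_normed_vector \<Rightarrow> 'a \<Rightarrow> real"
    and \<gamma> \<eta> :: "real \<Rightarrow> 'a"
    and \<alpha> \<kappa> :: "real \<Rightarrow> real"
    and T L :: "'a \<Rightarrow> 'a"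
    and w :: 'a
    and c :: real
  assumes "dim (UNIV :: 'a set) = 2"
    and "smooth_closed_curve (sphere (0::'a) 1)"
    and "contains_no_segment (sphere (0::'a) 1)"
    and "symplectic_form \<omega>"
    and "c > 0"
    and "legendre_curve {0..c} \<gamma> \<eta>"
    and "has_curvature \<omega> {0..c} \<gamma> \<eta> \<alpha> \<kappa>"
    and "plane_isometry T"
    and "linear L"
    and "\<And>x. T x = L x + w"
    and "orientation_preserving \<omega> L"
  shows "legendre_curve {0..c} (T \<circ> \<gamma>) (L \<circ> \<eta>) \<and>
         has_curvature \<omega> {0..c} (T \<circ> \<gamma>) (L \<circ> \<eta>) \<alpha> \<kappa>"
proof -
  let ?I = "{0..c}"
  interpret L: linear L by fact
  have iso: "norm (L x) = norm x" for x
    using assms(8,10) unfolding plane_isometry_def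
    by (metis L.diff add_diff_cancel_right diff_zero)
  have bl: "bounded_linear L"
    using iso by (intro bounded_linear_intro[where K = 1]) (auto simp: L.add L.scale)
  have T: "T \<circ> \<gamma> = (\<lambda>t. L (\<gamma> t) + w)" using assms(10) by auto
  have L: "L \<circ> \<eta> = (\<lambda>t. L (\<eta> t) + 0)" by auto
  have leg: "smooth_curve_on ?I \<gamma>" "smooth_curve_on ?I \<eta>"
    "\<And>t. t \<in> ?I \<Longrightarrow> \<eta> t \<in> sphere 0 1"
    "\<And>t. t \<in> ?I \<Longrightarrow> \<eta> t \<stileturn>\<^sub>B vector_derivative \<gamma> (at t within ?I)"
    using assms(6) unfolding legendre_curve_def by blast+
  have curv: "smooth_curve_on ?I \<alpha>" "smooth_curve_on ?I \<kappa>"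
    "\<And>t. t \<in> ?I \<Longrightarrow>
      (\<gamma> has_vector_derivative \<alpha> t *\<^sub>R birkhoff_normal \<omega> (\<eta> t)) (at t within ?I)"
    "\<And>t. t \<in> ?I \<Longrightarrow>
      (\<eta> has_vector_derivative \<kappa> t *\<^sub>R birkhoff_normal \<omega> (\<eta> t)) (at t within ?I)"
    using assms(7) unfolding has_curvature_def by blast+
  have der: "(T \<circ> \<gamma> has_vector_derivative L d) (at t within ?I)"
    if "(\<gamma> has_vector_derivative d) (at t within ?I)" for d t
    unfolding T has_vector_derivative_add_const
    by (rule bounded_linear.has_vector_derivative[OF bl that])
  have "L (\<eta> t) \<stileturn>\<^sub>B vector_derivative (T \<circ> \<gamma>) (at t within ?I)" if t: "t \<in> ?I" for t
  proof -
    let ?d = "vector_derivative \<gamma> (at t within ?I)"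
    have "(\<gamma> has_vector_derivative ?d) (at t within ?I)"
      using curv(3)[OF t] vector_derivative_works differentiableI_vector by blast
    from der[OF this] have "vector_derivative (T \<circ> \<gamma>) (at t within ?I) = L ?d"
      using vector_derivative_within_cbox[of 0 c t "T \<circ> \<gamma>"] \<open>c > 0\<close> t
      unfolding box_real by blast
    then show ?thesis
      using birkhoff_orthogonal_linear_isometry[OF \<open>linear L\<close> iso leg(4)[OF t]] by simp
  qed
  then have "legendre_curve ?I (T \<circ> \<gamma>) (L \<circ> \<eta>)"
    using smooth_curve_on_affine[OF bl leg(1), of w] smooth_curve_on_affine[OF bl leg(2), of 0]
      leg(3) iso
    unfolding legendre_curve_def T[symmetric] L[symmetric] by simp
  moreover have "has_curvature \<omega> ?I (T \<circ> \<gamma>) (L \<circ> \<eta>) \<alpha> \<kappa>"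
    unfolding has_curvature_def
  proof (intro conjI ballI curv(1,2))
    fix t assume t: "t \<in> ?I"
    have normal: "birkhoff_normal \<omega> ((L \<circ> \<eta>) t) = L (birkhoff_normal \<omega> (\<eta> t))"
      using birkhoff_normal_linear_isometry[OF assms(1,2,4) \<open>linear L\<close> iso assms(11) leg(3)[OF t]]
      by simp
    show "(T \<circ> \<gamma> has_vector_derivative \<alpha> t *\<^sub>R birkhoff_normal \<omega> ((L \<circ> \<eta>) t)) (at t within ?I)"
      unfolding normal using der[OF curv(3)[OF t]] by (simp add: L.scale)
    show "(L \<circ> \<eta> has_vector_derivative \<kappa> t *\<^sub>R birkhoff_normal \<omega> ((L \<circ> \<eta>) t)) (at t within ?I)"
      unfolding normal
      using bounded_linear.has_vector_derivative[OF bl curv(4)[OF t]] by (simp add: L.scale o_def)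
  qed
  ultimately show ?thesis by blast
qed

end
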